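(* Let $\alpha\neq0$ be a constant. The system of equations for functions $q_1,q_2,q_3$ of $(x,t)$ $$\alpha\frac{\partial q_1}{\partial t}=\frac{\partial}{\partial x}\Big(-5\frac{\partial^2q_1}{\partial x^2}+3q_1\frac{\partial}{\partial x}(3q_2+q_3)-2q_1^3+3q_1(q_2^2+q_3^2)\Big),$$ $$\alpha\frac{\partial q_2}{\partial t}=\frac{\partial}{\partial x}\Big(\frac{\partial^2}{\partial x^2}(4q_2+3q_3)+3q_2\frac{\partial q_3}{\partial x}-9q_1\frac{\partial q_1}{\partial x}+6q_3\frac{\partial q_3}{\partial x}-2q_2^3+3q_2(q_1^2+q_3^2)\Big),$$ $$\alpha\frac{\partial q_3}{\partial t}=\frac{\partial}{\partial x}\Big(\frac{\partial^2}{\partial x^2}(q_3+3q_2)-6q_3\frac{\partial q_2}{\partial x}-3q_1\frac{\partial q_1}{\partial x}-3q_2\frac{\partial q_2}{\partial x}-2q_3^3+3q_3(q_1^2+q_2^2)\Big)$$ can be written in the Hamiltonian form $$\frac{\partial q_i}{\partial t}=\frac{\partial}{\partial x}\frac{\delta H}{\delta q_i},\qquad i=1,2,3,$$ with the Hamiltonian $$H=\frac1\alpha\int_{-\infty}^{\infty}\mathrm{d}x\,\Big(-\frac12\sum_{i=1}^3q_i^4+\frac32\sum_{1\le i<j\le3}q_i^2q_j^2+\frac52\Big(\frac{\partial q_1}{\partial x}\Big)^2-2\Big(\frac{\partial q_2}{\partial x}\Big)^2-\frac12\Big(\frac{\partial q_3}{\partial x}\Big)^2$$ $$\qquad+\frac{\partial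 q_2}{\partial x}\Big(\frac92q_1^2-3q_3^2\Big)+\frac32\frac{\partial q_3}{\partial x}(q_1^2+q_2^2)-3\frac{\partial q_2}{\partial x}\frac{\partial q_3}{\partial x}\Big).$$
   Context: The functions $q_i(x,t)$ are smooth and, for each $t$, decay rapidly (together with all $x$-derivatives) as $|x|\to\infty$. $\delta H/\delta q_i$ denotes the variational (Euler-Lagrange) derivative: for a density $h$ depending on $q_j$ and $\partial_xq_j$ one has $\delta H/\delta q_i=\partial h/\partial q_i-\partial_x\big(\partial h/\partial(\partial_xq_i)\big)$ for $H=\int h\,\mathrm{d}x$. *)

theory Defs
  imports "HOL-Analysis.Analysis"
begin

(* The scalars are left generic: the sort {real_normed_field, euclidean_space} has real and complex
   as instances, so real-valued and complex-valued fields are both covered.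
   A field is written with time first: q i t x is q_i(x,t), so that q i t is the spatial profile
   at time t.  Only the indices 1, 2, 3 are meaningful. *)

definition D :: "(real \<Rightarrow> 'a::real_normed_vector) \<Rightarrow> real \<Rightarrow> 'a" where
  "D f x = vector_derivative f (at x)"

primrec C_class :: "nat \<Rightarrow> (real \<Rightarrow> real \<Rightarrow> 'a::real_normed_vector) \<Rightarrow> bool" where
  "C_class 0 f \<longleftrightarrow> continuous_on UNIV (\<lambda>(t, x). f t x)"
| "C_class (Suc k) f \<longleftrightarrow>
     (\<forall>t x. (\<lambda>s. f s x) differentiable (at t) \<and> f t differentiable (at x)) \<and>
     C_class k (\<lambda>t x. D (\<lambda>s. f s x) t) \<and> C_class k (\<lambda>t x. D (f t) x)"

definition smooth :: "(real \<Rightarrow> real \<Rightarrow> 'a::real_normed_vector) \<Rightarrow> bool" where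
  "smooth f \<longleftrightarrow> (\<forall>k. C_class k f)"

definition schwartz :: "(real \<Rightarrow> 'a::real_normed_vector) \<Rightarrow> bool" where
  "schwartz f \<longleftrightarrow>
     (\<forall>n x. (D ^^ n) f differentiable (at x)) \<and>
     (\<forall>m n. ((\<lambda>x. x ^ m *\<^sub>R (D ^^ n) f x) \<longlongrightarrow> 0) at_infinity)"

(* A density h u v depends on the field values u j (= q_j) and on their x-derivatives v j. *)
definition euler_lagrange ::
    "((nat \<Rightarrow> 'a) \<Rightarrow> (nat \<Rightarrow> 'a) \<Rightarrow> 'a) \<Rightarrow> nat \<Rightarrow> (nat \<Rightarrow> real \<Rightarrow> 'a::real_normed_field) \<Rightarrow> real \<Rightarrow> 'a" where
  "euler_lagrange h i w x =
     deriv (\<lambda>s. h ((\<lambda>j. w j x)(i := s)) (\<lambda>j. D (w j) x)) (w i x)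
     - D (\<lambda>y. deriv (\<lambda>s. h (\<lambda>j. w j y) ((\<lambda>j. D (w j) y)(i := s))) (D (w i) y)) x"

(* g represents the first variation of the functional F at w in the i-th component. *)
definition has_variational_derivative ::
    "((nat \<Rightarrow> real \<Rightarrow> 'a) \<Rightarrow> 'a) \<Rightarrow> nat \<Rightarrow> (nat \<Rightarrow> real \<Rightarrow> 'a) \<Rightarrow>
     (real \<Rightarrow> 'a::{real_normed_field, euclidean_space}) \<Rightarrow> bool" where
  "has_variational_derivative F i w g \<longleftrightarrow>
     (\<forall>\<eta>. schwartz \<eta> \<longrightarrow>
        integrable lborel (\<lambda>x. g x * \<eta> x) \<and>
        ((\<lambda>\<epsilon>. F (w(i := (\<lambda>x. w i x + \<epsilon> *\<^sub>R \<eta> x))))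
           has_vector_derivative (LINT x|lborel. g x * \<eta> x)) (at 0))"

definition ham_density :: "(nat \<Rightarrow> 'a) \<Rightarrow> (nat \<Rightarrow> 'a) \<Rightarrow> 'a::real_normed_field" where
  "ham_density u v =
     - (1/2) * (\<Sum>i=1..3. u i ^ 4)
     + (3/2) * (\<Sum>j=1..3. \<Sum>i=1..<j. (u i)\<^sup>2 * (u j)\<^sup>2)
     + (5/2) * (v 1)\<^sup>2 - 2 * (v 2)\<^sup>2 - (1/2) * (v 3)\<^sup>2
     + v 2 * ((9/2) * (u 1)\<^sup>2 - 3 * (u 3)\<^sup>2)
     + (3/2) * v 3 * ((u 1)\<^sup>2 + (u 2)\<^sup>2)
     - 3 * v 2 * v 3"

definition hamiltonian ::
    "'a \<Rightarrow> (nat \<Rightarrow> real \<Rightarrow> 'a) \<Rightarrow> 'a::{real_normed_field, euclidean_space}" where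
  "hamiltonian \<alpha> w = (1 / \<alpha>) * (LINT x|lborel. ham_density (\<lambda>j. w j x) (\<lambda>j. D (w j) x))"

definition field_equations ::
    "'a \<Rightarrow> (nat \<Rightarrow> real \<Rightarrow> real \<Rightarrow> 'a::real_normed_field) \<Rightarrow> bool" where
  "field_equations \<alpha> q \<longleftrightarrow> (\<forall>t x.
     \<alpha> * D (\<lambda>s. q 1 s x) t =
       D (\<lambda>y. - 5 * D (D (q 1 t)) y + 3 * q 1 t y * D (\<lambda>z. 3 * q 2 t z + q 3 t z) y
              - 2 * q 1 t y ^ 3 + 3 * q 1 t y * ((q 2 t y)\<^sup>2 + (q 3 t y)\<^sup>2)) x \<and>
     \<alpha> * D (\<lambda>s. q 2 s x) t =
       D (\<lambda>y. D (D (\<lambda>z. 4 * q 2 t z + 3 * q 3 t z)) y + 3 * q 2 t y * D (q 3 t) y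
              - 9 * q 1 t y * D (q 1 t) y + 6 * q 3 t y * D (q 3 t) y
              - 2 * q 2 t y ^ 3 + 3 * q 2 t y * ((q 1 t y)\<^sup>2 + (q 3 t y)\<^sup>2)) x \<and>
     \<alpha> * D (\<lambda>s. q 3 s x) t =
       D (\<lambda>y. D (D (\<lambda>z. q 3 t z + 3 * q 2 t z)) y - 6 * q 3 t y * D (q 2 t) y
              - 3 * q 1 t y * D (q 1 t) y - 3 * q 2 t y * D (q 2 t) y
              - 2 * q 3 t y ^ 3 + 3 * q 3 t y * ((q 1 t y)\<^sup>2 + (q 2 t y)\<^sup>2)) x)"

end

(* In each slot (q i, its x-derivative) the density is a quartic in q i plus a quadratic in the
   derivative, with rapidly decaying coefficients. Perturbing q i by \<epsilon> \<eta> makes H a polynomial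
   in \<epsilon>, so its first variation is the integral of the linear coefficient, and the integral of
   a derivative of a decaying function vanishes (integration by parts). Evaluating the
   Euler-Lagrange expressions gives the right-hand sides of the system, divided by \<alpha>. *)

theory Submission
  imports Defs "HOL-Probability.Sinc_Integral"
begin

section \<open>Continuous functions with quadratic decay\<close>

text \<open>The majorant 1/(1 + x^2) is integrable, bounded by 1 and tends to 0 at both ends. This
  one class is therefore closed under sums and products and also gives both integrability and
  vanishing boundary terms, so products of Schwartz functions need not be shown to be
  Schwartz.\<close>

definition quad_decay :: "(real \<Rightarrow> 'a::real_normed_vector) \<Rightarrow> bool" where
  "quad_decay f \<longleftrightarrow>
     continuous_on UNIV f \<and> (\<exists>C. \<forall>x. norm (f x) \<le> C * inverse (1 + x\<^sup>2))"

lemma quad_decayE: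
  assumes "quad_decay f"
  obtains C where "C \<ge> 0" "\<And>x. norm (f x) \<le> C * inverse (1 + x\<^sup>2)"
proof -
  obtain C where C: "\<And>x. norm (f x) \<le> C * inverse (1 + x\<^sup>2)"
    using assms unfolding quad_decay_def by blast
  have "C \<ge> 0"
    using order_trans[OF norm_ge_zero C[of 0]] by simp
  with C show thesis by (rule that[rotated])
qed

lemma quad_decay_add:
  assumes "quad_decay f" "quad_decay g"
  shows "quad_decay (\<lambda>x. f x + g x)"
proof -
  obtain A B where A: "\<And>x. norm (f x) \<le> A * inverse (1 + x\<^sup>2)"
    and B: "\<And>x. norm (g x) \<le> B * inverse (1 + x\<^sup>2)"
    using assms by (metis quad_decayE)
  have "norm (f x + g x) \<le> (A + B) * inverse (1 + x\<^sup>2)" for x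
    using norm_triangle_le[OF add_mono[OF A[of x] B[of x]]] by (simp add: distrib_right)
  then show ?thesis
    using assms unfolding quad_decay_def by (blast intro: continuous_on_add)
qed

lemma quad_decay_cmult:
  fixes c :: "'a::real_normed_algebra"
  assumes "quad_decay f"
  shows "quad_decay (\<lambda>x. c * f x)"
proof -
  obtain A where A: "\<And>x. norm (f x) \<le> A * inverse (1 + x\<^sup>2)"
    using assms by (metis quad_decayE)
  have "norm (c * f x) \<le> (norm c * A) * inverse (1 + x\<^sup>2)" for x
    using order_trans[OF norm_mult_ineq mult_left_mono[OF A norm_ge_zero]]
    by (simp add: mult.assoc)
  moreover have "continuous_on UNIV (\<lambda>x. c * f x)"
    using assms by (auto simp: quad_decay_def intro: continuous_on_mult_left)
  ultimately show ?thesis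
    unfolding quad_decay_def by blast
qed

text \<open>One factor enters only through its bound \<open>A\<close>, as 1/(1 + x^2) is at most 1;
  the other factor supplies the decay.\<close>

lemma quad_decay_mult:
  fixes f g :: "real \<Rightarrow> 'a::real_normed_algebra"
  assumes "quad_decay f" "quad_decay g"
  shows "quad_decay (\<lambda>x. f x * g x)"
proof -
  obtain A B where "A \<ge> 0" and A: "\<And>x. norm (f x) \<le> A * inverse (1 + x\<^sup>2)"
    and "B \<ge> 0" and B: "\<And>x. norm (g x) \<le> B * inverse (1 + x\<^sup>2)"
    using assms by (metis quad_decayE)
  have "norm (f x * g x) \<le> (A * B) * inverse (1 + x\<^sup>2)" for x
  proof -
    have "A * inverse (1 + x\<^sup>2) \<le> A * 1"
      using \<open>A \<ge> 0\<close> by (intro mult_left_mono) (simp_all add: inverse_le_1_iff)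
    then have "norm (f x) \<le> A" using A[of x] by linarith
    then have "norm (f x) * norm (g x) \<le> A * (B * inverse (1 + x\<^sup>2))"
      using B[of x] \<open>A \<ge> 0\<close> by (intro mult_mono) auto
    then show ?thesis using norm_mult_ineq[of "f x" "g x"] by simp
  qed
  then show ?thesis
    using assms unfolding quad_decay_def by (blast intro: continuous_on_mult)
qed

lemma quad_decay_diff:
  fixes f g :: "real \<Rightarrow> 'a::real_normed_algebra_1"
  shows "quad_decay f \<Longrightarrow> quad_decay g \<Longrightarrow> quad_decay (\<lambda>x. f x - g x)"
  using quad_decay_add[of f "\<lambda>x. - 1 * g x"] quad_decay_cmult[of g "- 1"] by simp

text \<open>Exponent 0 is excluded because the constant 1 does not decay.\<close>

lemma quad_decay_power:
  fixes f :: "real \<Rightarrow> 'a::real_normed_algebra_1"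
  assumes "quad_decay f" "n > 0"
  shows "quad_decay (\<lambda>x. f x ^ n)"
  using assms(2,1) by (induction n rule: nat_induct_non_zero) (auto intro: quad_decay_mult)


lemma quad_decay_integrable:
  fixes f :: "real \<Rightarrow> 'a::euclidean_space"
  assumes "quad_decay f"
  shows "integrable lborel f"
proof -
  obtain C where C: "\<And>x. norm (f x) \<le> C * inverse (1 + x\<^sup>2)"
    using assms by (metis quad_decayE)
  have "integrable lborel (\<lambda>x::real. C * inverse (1 + x\<^sup>2))"
    using integrable_inverse_1_plus_square by (simp add: set_integrable_def)
  then show ?thesis
  proof (rule Bochner_Integration.integrable_bound)
    show "f \<in> borel_measurable lborel"
      using assms by (simp add: quad_decay_def borel_measurable_continuous_onI)
    show "AE x in lborel. norm (f x) \<le> norm (C * inverse (1 + x\<^sup>2))"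
      using C by (intro AE_I2) (metis abs_ge_self order_trans real_norm_def)
  qed
qed

text \<open>The filter is left generic so that both ends of the real line are served.\<close>

lemma quad_decay_tendsto_0:
  assumes "quad_decay f" and F: "filterlim (\<lambda>x::real. inverse (1 + x\<^sup>2)) (nhds 0) F"
  shows "(f \<longlongrightarrow> 0) F"
proof -
  obtain C where C: "\<And>x. norm (f x) \<le> C * inverse (1 + x\<^sup>2)"
    using assms by (metis quad_decayE)
  have "((\<lambda>x. C * inverse (1 + x\<^sup>2)) \<longlongrightarrow> 0) F"
    using tendsto_mult_right_zero[OF F] .
  then show ?thesis
    by (rule Lim_null_comparison[rotated]) (simp add: C)
qed

text \<open>Fundamental theorem of calculus on the whole line, with boundary values 0 by the decay
  of \<open>F\<close>. This is the integration by parts behind the first variation.\<close>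

lemma LINT_derivative_eq_0:
  fixes F f :: "real \<Rightarrow> 'a::euclidean_space"
  assumes der: "\<And>x. (F has_vector_derivative f x) (at x)"
    and F: "quad_decay F" and f: "quad_decay f"
  shows "(LINT x|lborel. f x) = 0"
proof -
  have "(LBINT x=-\<infinity>..\<infinity>. f x) = 0 - 0"
  proof (rule interval_integral_FTC_integrable[where F = F])
    show "set_integrable lborel (einterval (-\<infinity>) \<infinity>) f"
      using quad_decay_integrable[OF f] by (simp add: set_integrable_def)
    show "isCont f x" for x
      using f by (simp add: quad_decay_def continuous_on_eq_continuous_at)
    show "((F \<circ> real_of_ereal) \<longlongrightarrow> 0) (at_right (-\<infinity>))"
      unfolding ereal_tendsto_simps1
      by (rule quad_decay_tendsto_0[OF F]) real_asymp
    show "((F \<circ> real_of_ereal) \<longlongrightarrow> 0) (at_left \<infinity>)"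
      unfolding ereal_tendsto_simps1
      by (rule quad_decay_tendsto_0[OF F]) real_asymp
  qed (simp_all add: der)
  then show ?thesis
    by (simp add: interval_lebesgue_integral_def set_lebesgue_integral_def)
qed

section \<open>Derivatives and decay of Schwartz functions\<close>

lemma has_vector_derivative_D:
  "f differentiable (at x) \<Longrightarrow> (f has_vector_derivative D f x) (at x)"
  unfolding D_def by (simp add: vector_derivative_works)

lemma D_eq: "(f has_vector_derivative f') (at x) \<Longrightarrow> D f x = f'"
  unfolding D_def by (rule vector_derivative_at)

lemma schwartz_differentiable:
  assumes "schwartz f"
  shows "f differentiable (at x)" "D f differentiable (at x)" "D (D f) differentiable (at x)"
proof -
  have *: "(D ^^ n) f differentiable (at x)" for n
    using assms by (simp add: schwartz_def)
  show "f differentiable (at x)" "D f differentiable (at x)" "D (D f) differentiable (at x)"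
    using *[of 0] *[of 1] *[of 2] by (simp_all add: numeral_2_eq_2)
qed

text \<open>The rescaled function (1 + x^2) g(x) tends to 0, hence is below 1 outside some ball, and
  on that compact ball it is bounded by continuity.\<close>

lemma quad_decayI:
  fixes g :: "real \<Rightarrow> 'a::real_normed_vector"
  assumes cont: "continuous_on UNIV g"
    and lim0: "(g \<longlongrightarrow> 0) at_infinity" and lim2: "((\<lambda>x. x\<^sup>2 *\<^sub>R g x) \<longlongrightarrow> 0) at_infinity"
  shows "quad_decay g"
proof -
  define k where "k x = (1 + x\<^sup>2) *\<^sub>R g x" for x
  have "(k \<longlongrightarrow> 0) at_infinity"
    using tendsto_add[OF lim0 lim2]
    by (simp only: k_def[abs_def] scaleR_add_left scaleR_one add_0_left)
  from tendstoD[OF this zero_less_one] have "\<forall>\<^sub>F x in at_infinity. norm (k x) < 1"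
    by simp
  then obtain b where b: "\<And>x. norm x \<ge> b \<Longrightarrow> norm (k x) < 1"
    by (auto simp: eventually_at_infinity)
  have "continuous_on UNIV k"
    unfolding k_def[abs_def] by (intro continuous_intros cont)
  then have "continuous_on (cball 0 b) k"
    by (rule continuous_on_subset) simp
  then have "bounded (k ` cball 0 b)"
    by (intro compact_imp_bounded compact_continuous_image compact_cball)
  then obtain B where B: "\<And>x. x \<in> cball 0 b \<Longrightarrow> norm (k x) \<le> B"
    unfolding bounded_iff by blast
  have "norm (g x) \<le> max 1 B * inverse (1 + x\<^sup>2)" for x
  proof -
    have "norm (k x) \<le> max 1 B"
      using b[of x] B[of x] by (cases "norm x \<ge> b") auto
    moreover have "norm (k x) = (1 + x\<^sup>2) * norm (g x)"
      unfolding k_def norm_scaleR by (simp add: add_nonneg_nonneg)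
    moreover have "1 + x\<^sup>2 > 0"
      by (simp add: add_pos_nonneg)
    ultimately show ?thesis
      by (simp add: field_simps)
  qed
  with cont show ?thesis unfolding quad_decay_def by blast
qed

text \<open>The moments \<open>m = 0\<close> and \<open>m = 2\<close> give the two limits required
  by \<open>quad_decayI\<close>; derivatives up to order 2 are those occurring in the Euler-Lagrange
  expressions.\<close>

lemma schwartz_quad_decay:
  assumes "schwartz f"
  shows "quad_decay (D (D f))" "quad_decay (D f)" "quad_decay f"
proof -
  have *: "quad_decay ((D ^^ n) f)" for n
  proof (rule quad_decayI)
    show "continuous_on UNIV ((D ^^ n) f)"
      using assms by (auto simp: schwartz_def continuous_on_eq_continuous_at
          intro!: differentiable_imp_continuous_within)
    have "((\<lambda>x. x ^ m *\<^sub>R (D ^^ n) f x) \<longlongrightarrow> 0) at_infinity" for m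
      using assms by (simp add: schwartz_def)
    from this[of 0] this[of 2]
    show "((D ^^ n) f \<longlongrightarrow> 0) at_infinity"
      "((\<lambda>x. x\<^sup>2 *\<^sub>R (D ^^ n) f x) \<longlongrightarrow> 0) at_infinity" by simp_all
  qed
  show "quad_decay (D (D f))" "quad_decay (D f)" "quad_decay f"
    using *[of 0] *[of 1] *[of 2] by (simp_all add: numeral_2_eq_2)
qed

text \<open>With these rules in this order (and \<open>schwartz_quad_decay\<close>, whose last case
  matches every function, after them) repeated resolution needs no backtracking.\<close>

lemmas quad_decay_rules = quad_decay_cmult quad_decay_add quad_decay_diff
  quad_decay_power[OF _ zero_less_numeral]
  quad_decay_mult

section \<open>Variational calculus for a single slot of the density\<close>

text \<open>As a function of the slot (u i, v i) = (s, r) alone, the Hamiltonian density is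
  quartic in s and quadratic in r without mixed terms; this covers i = 1, 2, 3 uniformly.\<close>

locale quartic_slice =
  fixes p :: "(nat \<Rightarrow> 'a) \<Rightarrow> (nat \<Rightarrow> 'a) \<Rightarrow> 'a::{real_normed_field, euclidean_space}"
    and i :: nat and w :: "nat \<Rightarrow> real \<Rightarrow> 'a"
    and K :: "real \<Rightarrow> 'a" and c :: 'a and L L' R :: "real \<Rightarrow> 'a"
  assumes slice: "\<And>x s r. p ((\<lambda>j. w j x)(i := s)) ((\<lambda>j. D (w j) x)(i := r)) =
      - (1/2) * s ^ 4 + K x * s\<^sup>2 + c * r\<^sup>2 + L x * r + R x"
    and schwartz: "schwartz (w i)"
    and decay: "quad_decay K" "quad_decay L" "quad_decay L'" "quad_decay R"
    and L': "\<And>x. (L has_vector_derivative L' x) (at x)"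
begin

text \<open>Euler-Lagrange expression of the slice: its \<open>s\<close>-derivative minus the
  x-derivative of its \<open>r\<close>-derivative \<open>2 * c * r + L x\<close>, evaluated along
  the field.\<close>

definition E :: "real \<Rightarrow> 'a" where
  "E x = 2 * (K x * w i x) - 2 * w i x ^ 3 - (2 * (c * D (D (w i)) x) + L' x)"

text \<open>Updating a slot with its present value changes nothing. Freezing \<open>r\<close> here,
  and \<open>s\<close> in the next lemma, gives the one-variable functions that
  \<open>euler_lagrange\<close> differentiates.\<close>

lemma slice_field:
  "p ((\<lambda>j. w j x)(i := s)) (\<lambda>j. D (w j) x) =
    - (1/2) * s ^ 4 + K x * s\<^sup>2 + c * (D (w i) x)\<^sup>2 + L x * D (w i) x + R x"
  using slice[of x s "D (w i) x"] unfolding fun_upd_triv[of "\<lambda>j. D (w j) x" i] .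

lemma slice_derivative:
  "p (\<lambda>j. w j x) ((\<lambda>j. D (w j) x)(i := r)) =
    - (1/2) * w i x ^ 4 + K x * (w i x)\<^sup>2 + c * r\<^sup>2 + L x * r + R x"
  using slice[of x "w i x" r] unfolding fun_upd_triv[of "\<lambda>j. w j x" i] .

lemma E_decay: "quad_decay E"
  unfolding E_def
  by (assumption | rule quad_decay_rules decay schwartz_quad_decay schwartz)+

lemma density_decay: "quad_decay (\<lambda>x. p (\<lambda>j. w j x) (\<lambda>j. D (w j) x))"
proof -
  have "quad_decay (\<lambda>x. - (1/2) * w i x ^ 4 + K x * (w i x)\<^sup>2 + c * (D (w i) x)\<^sup>2
      + L x * D (w i) x + R x)"
    by (assumption | rule quad_decay_rules decay schwartz_quad_decay schwartz)+
  moreover have "p (\<lambda>j. w j x) (\<lambda>j. D (w j) x) = - (1/2) * w i x ^ 4 + K x * (w i x)\<^sup>2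
      + c * (D (w i) x)\<^sup>2 + L x * D (w i) x + R x" for x
    using slice_field[of x "w i x"] unfolding fun_upd_triv[of "\<lambda>j. w j x" i] .
  ultimately show ?thesis
    by simp
qed

text \<open>The scalar \<beta> will be 1/\<alpha>. The two inner derivatives are field derivatives
  of a polynomial in one slot; only the outer one runs along the real line, and there
  \<open>L'\<close> enters.\<close>

lemma euler_lagrange_eq:
  "euler_lagrange (\<lambda>u v. \<beta> * p u v) i w = (\<lambda>x. \<beta> * E x)"
proof
  fix x
  have 1: "deriv (\<lambda>s. \<beta> * p ((\<lambda>j. w j x)(i := s)) (\<lambda>j. D (w j) x)) (w i x)
      = \<beta> * (2 * (K x * w i x) - 2 * w i x ^ 3)"
  proof (rule DERIV_imp_deriv)
    have "(\<lambda>s. \<beta> * p ((\<lambda>j. w j x)(i := s)) (\<lambda>j. D (w j) x)) = (\<lambda>s. \<beta> *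
        (- (1/2) * s ^ 4 + K x * s\<^sup>2 + c * (D (w i) x)\<^sup>2 + L x * D (w i) x + R x))"
      by (simp only: slice_field)
    then show "((\<lambda>s. \<beta> * p ((\<lambda>j. w j x)(i := s)) (\<lambda>j. D (w j) x)) has_field_derivative
        \<beta> * (2 * (K x * w i x) - 2 * w i x ^ 3)) (at (w i x))"
      by (auto intro!: derivative_eq_intros simp: algebra_simps)
  qed
  have 2: "deriv (\<lambda>s. \<beta> * p (\<lambda>j. w j y) ((\<lambda>j. D (w j) y)(i := s))) (D (w i) y)
      = \<beta> * (2 * (c * D (w i) y) + L y)" for y
  proof (rule DERIV_imp_deriv)
    have "(\<lambda>s. \<beta> * p (\<lambda>j. w j y) ((\<lambda>j. D (w j) y)(i := s))) = (\<lambda>s. \<beta> *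
        (- (1/2) * w i y ^ 4 + K y * (w i y)\<^sup>2 + c * s\<^sup>2 + L y * s + R y))"
      by (simp only: slice_derivative)
    then show "((\<lambda>s. \<beta> * p (\<lambda>j. w j y) ((\<lambda>j. D (w j) y)(i := s))) has_field_derivative
        \<beta> * (2 * (c * D (w i) y) + L y)) (at (D (w i) y))"
      by (auto intro!: derivative_eq_intros simp: algebra_simps)
  qed
  have 3: "D (\<lambda>y. \<beta> * (2 * (c * D (w i) y) + L y)) x = \<beta> * (2 * (c * D (D (w i)) x) + L' x)"
    by (intro D_eq has_vector_derivative_mult_right has_vector_derivative_add L'
        has_vector_derivative_D schwartz_differentiable schwartz)
  show "euler_lagrange (\<lambda>u v. \<beta> * p u v) i w x = \<beta> * E x"
    unfolding euler_lagrange_def 1 2 3 E_def by (simp add: algebra_simps)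
qed

text \<open>All coefficients of the polynomial in \<epsilon> are integrable, so linearity of the
  integral replaces differentiation under the integral sign.\<close>

lemma has_variational_derivative:
  "has_variational_derivative
     (\<lambda>w. \<beta> * (LINT x|lborel. p (\<lambda>j. w j x) (\<lambda>j. D (w j) x))) i w (\<lambda>x. \<beta> * E x)"
  unfolding has_variational_derivative_def
proof (intro allI impI)
  fix \<eta> :: "real \<Rightarrow> 'a"
  assume \<eta>: "schwartz \<eta>"
  \<comment> \<open>\<open>A\<close>, \<open>B\<close>, \<open>C2\<close>, \<open>C3\<close>,
    \<open>C4\<close> are the coefficients of \<epsilon> to the powers 0 to 4 in the perturbed
    density.\<close>
  define A where "A x = - (1/2) * w i x ^ 4 + K x * (w i x)\<^sup>2 + c * (D (w i) x)\<^sup>2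
      + L x * D (w i) x + R x" for x
  define B where "B x = 2 * (K x * w i x * \<eta> x) - 2 * (w i x ^ 3 * \<eta> x)
      + (2 * (c * (D (w i) x * D \<eta> x)) + L x * D \<eta> x)" for x
  define C2 where "C2 x = K x * (\<eta> x)\<^sup>2 - 3 * ((w i x)\<^sup>2 * (\<eta> x)\<^sup>2) + c * (D \<eta> x)\<^sup>2" for x
  define C3 where "C3 x = - 2 * (w i x * \<eta> x ^ 3)" for x
  define C4 where "C4 x = - (1/2) * \<eta> x ^ 4" for x
  \<comment> \<open>Boundary term of the integration by parts: the \<open>r\<close>-derivative of
    the slice times the test function.\<close>
  define G where "G x = (2 * (c * D (w i) x) + L x) * \<eta> x" for x
  note decays = quad_decay_rules decay schwartz_quad_decay schwartz \<eta>
  have dec: "quad_decay A" "quad_decay B" "quad_decay C2" "quad_decay C3" "quad_decay C4"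
    "quad_decay G"
    unfolding A_def B_def C2_def C3_def C4_def G_def by (assumption | rule decays)+
  have E\<eta>: "quad_decay (\<lambda>x. E x * \<eta> x)"
    by (rule quad_decay_mult[OF E_decay]) (rule schwartz_quad_decay[OF \<eta>])
  have int: "integrable lborel A" "integrable lborel B" "integrable lborel C2"
    "integrable lborel C3" "integrable lborel C4" "integrable lborel (\<lambda>x. E x * \<eta> x)"
    using dec E\<eta> by (simp_all add: quad_decay_integrable)
  \<comment> \<open>The difference is exactly the derivative of \<open>G\<close>: the terms with
    \<open>K\<close> and the cubic term cancel.\<close>
  have "(LINT x|lborel. B x - E x * \<eta> x) = 0"
  proof (rule LINT_derivative_eq_0[where F = G])
    have "(G has_vector_derivative (2 * (c * D (w i) x) + L x) * D \<eta> x
        + (2 * (c * D (D (w i)) x) + L' x) * \<eta> x) (at x)" for x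
      unfolding G_def
      by (intro has_vector_derivative_mult has_vector_derivative_mult_right
          has_vector_derivative_add L' has_vector_derivative_D schwartz_differentiable schwartz \<eta>)
    moreover have "B x - E x * \<eta> x = (2 * (c * D (w i) x) + L x) * D \<eta> x
        + (2 * (c * D (D (w i)) x) + L' x) * \<eta> x" for x
      unfolding B_def E_def by (simp add: algebra_simps)
    ultimately show "(G has_vector_derivative B x - E x * \<eta> x) (at x)" for x by simp
  qed (use dec E\<eta> in \<open>auto intro: quad_decay_diff\<close>)
  then have first: "(LINT x|lborel. B x) = (LINT x|lborel. E x * \<eta> x)"
    using int by simp
  have expand: "p (\<lambda>j. (w(i := \<lambda>x. w i x + \<epsilon> *\<^sub>R \<eta> x)) j x)
        (\<lambda>j. D ((w(i := \<lambda>x. w i x + \<epsilon> *\<^sub>R \<eta> x)) j) x)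
      = A x + \<epsilon> *\<^sub>R B x + \<epsilon>\<^sup>2 *\<^sub>R C2 x + \<epsilon> ^ 3 *\<^sub>R C3 x + \<epsilon> ^ 4 *\<^sub>R C4 x" for x \<epsilon>
  proof -
    have D\<epsilon>: "D (\<lambda>x. w i x + \<epsilon> *\<^sub>R \<eta> x) x = D (w i) x + \<epsilon> *\<^sub>R D \<eta> x"
      by (auto intro!: D_eq has_vector_derivative_D schwartz_differentiable schwartz \<eta>
          derivative_eq_intros)
    have upd: "(\<lambda>j. (w(i := \<lambda>x. w i x + \<epsilon> *\<^sub>R \<eta> x)) j x) = (\<lambda>j. w j x)(i := w i x + \<epsilon> *\<^sub>R \<eta> x)"
      "(\<lambda>j. D ((w(i := \<lambda>x. w i x + \<epsilon> *\<^sub>R \<eta> x)) j) x)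
        = (\<lambda>j. D (w j) x)(i := D (w i) x + \<epsilon> *\<^sub>R D \<eta> x)"
      by (auto simp: fun_eq_iff D\<epsilon>)
    show ?thesis
      unfolding upd
      \<comment> \<open>Writing \<open>scaleR\<close> as multiplication by \<open>of_real\<close>
        leaves a polynomial identity in a commutative ring.\<close>
      unfolding slice A_def B_def C2_def C3_def C4_def scaleR_conv_of_real of_real_power
      by algebra
  qed
  have F: "\<beta> * (LINT x|lborel. p (\<lambda>j. (w(i := \<lambda>x. w i x + \<epsilon> *\<^sub>R \<eta> x)) j x)
        (\<lambda>j. D ((w(i := \<lambda>x. w i x + \<epsilon> *\<^sub>R \<eta> x)) j) x))
      = \<beta> * (integral\<^sup>L lborel A + \<epsilon> *\<^sub>R integral\<^sup>L lborel B + \<epsilon>\<^sup>2 *\<^sub>R integral\<^sup>L lborel C2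
        + \<epsilon> ^ 3 *\<^sub>R integral\<^sup>L lborel C3 + \<epsilon> ^ 4 *\<^sub>R integral\<^sup>L lborel C4)" for \<epsilon>
    unfolding expand using int by simp
  show "integrable lborel (\<lambda>x. \<beta> * E x * \<eta> x) \<and>
    ((\<lambda>\<epsilon>. \<beta> * (LINT x|lborel. p (\<lambda>j. (w(i := \<lambda>x. w i x + \<epsilon> *\<^sub>R \<eta> x)) j x)
        (\<lambda>j. D ((w(i := \<lambda>x. w i x + \<epsilon> *\<^sub>R \<eta> x)) j) x)))
      has_vector_derivative (LINT x|lborel. \<beta> * E x * \<eta> x)) (at 0)"
    \<comment> \<open>At \<epsilon> = 0 the powers from the second on have derivative 0, so only the
      integral of \<open>B\<close> survives, and \<open>first\<close> rewrites it.\<close>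
    unfolding F using int
    by (auto intro!: derivative_eq_intros simp: mult.assoc first)
qed

end

section \<open>The Hamiltonian density and its three slices\<close>

lemma atLeastAtMost_1_3: "{1..3::nat} = {1, 2, 3}"
  by auto

text \<open>With the sums unrolled, an update of one slot can be evaluated term by term, and each
  slice condition becomes a ring identity.\<close>

lemma ham_density_expand:
  "ham_density u v = - (1/2) * (u 1 ^ 4 + u 2 ^ 4 + u 3 ^ 4)
     + (3/2) * ((u 1)\<^sup>2 * (u 2)\<^sup>2 + (u 1)\<^sup>2 * (u 3)\<^sup>2 + (u 2)\<^sup>2 * (u 3)\<^sup>2)
     + (5/2) * (v 1)\<^sup>2 - 2 * (v 2)\<^sup>2 - (1/2) * (v 3)\<^sup>2
     + v 2 * ((9/2) * (u 1)\<^sup>2 - 3 * (u 3)\<^sup>2)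
     + (3/2) * v 3 * ((u 1)\<^sup>2 + (u 2)\<^sup>2)
     - 3 * v 2 * v 3"
proof -
  have sum3: "(\<Sum>i=1..3. f i) = f 1 + f 2 + f 3" for f :: "nat \<Rightarrow> 'a"
    unfolding atLeastAtMost_1_3 by (simp add: add.assoc)
  \<comment> \<open>For j = 1 the inner sum is empty, so exactly the three pairs i < j
    remain.\<close>
  have below: "{1..<1::nat} = {}" "{1..<2::nat} = {1}" "{1..<3::nat} = {1, 2}"
    by auto
  have sum_lt: "(\<Sum>j=1..3. \<Sum>i=1..<j. f i j) = f 1 2 + f 1 3 + f 2 3"
    for f :: "nat \<Rightarrow> nat \<Rightarrow> 'a"
    unfolding sum3 below by (simp add: add.assoc)
  show ?thesis
    unfolding ham_density_def sum_lt sum3 ..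
qed

text \<open>Just enough to compare the indices 1, 2, 3 and resolve the conditionals; under
  \<open>simp only\<close> the polynomials stay as they are for \<open>algebra\<close>.\<close>

lemmas index_simps = one_eq_numeral_iff numeral_eq_one_iff numeral_eq_iff num.simps simp_thms
  if_True if_False

context
  fixes w :: "nat \<Rightarrow> real \<Rightarrow> 'a::{real_normed_field, euclidean_space}"
  assumes schwartz: "schwartz (w 1)" "schwartz (w 2)" "schwartz (w 3)"
begin

lemmas has_der = schwartz[THEN schwartz_differentiable(1), THEN has_vector_derivative_D]
  schwartz[THEN schwartz_differentiable(2), THEN has_vector_derivative_D]

lemma quartic_slice_1: "quartic_slice ham_density 1 w
    (\<lambda>x. (3/2) * ((w 2 x)\<^sup>2 + (w 3 x)\<^sup>2) + (9/2) * D (w 2) x + (3/2) * D (w 3) x)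
    (5/2) (\<lambda>x. 0 * w 1 x) (\<lambda>x. 0 * w 1 x)
    (\<lambda>x. - (1/2) * (w 2 x ^ 4 + w 3 x ^ 4) + (3/2) * ((w 2 x)\<^sup>2 * (w 3 x)\<^sup>2)
      - 2 * (D (w 2) x)\<^sup>2 - (1/2) * (D (w 3) x)\<^sup>2 - 3 * (D (w 2) x * (w 3 x)\<^sup>2)
      + (3/2) * (D (w 3) x * (w 2 x)\<^sup>2) - 3 * (D (w 2) x * D (w 3) x))"
  \<comment> \<open>\<open>0 * w 1 x\<close> instead of \<open>0\<close> keeps the decay rules applicable.\<close>
proof
  show "((\<lambda>x. 0 * w 1 x) has_vector_derivative 0 * w 1 x) (at x)" for x by simp
qed ((assumption | rule quad_decay_rules schwartz_quad_decay schwartz)+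
    | (simp only: ham_density_expand fun_upd_apply index_simps, algebra))+

text \<open>The cross term \<open>- 3 * v 2 * v 3\<close> puts a first derivative of
  \<open>w 3\<close> into the linear coefficient \<open>L\<close>, hence a second derivative into
  \<open>L'\<close>.\<close>

lemma quartic_slice_2: "quartic_slice ham_density 2 w
    (\<lambda>x. (3/2) * ((w 1 x)\<^sup>2 + (w 3 x)\<^sup>2) + (3/2) * D (w 3) x)
    (- 2) (\<lambda>x. (9/2) * (w 1 x)\<^sup>2 - 3 * (w 3 x)\<^sup>2 - 3 * D (w 3) x)
    (\<lambda>x. 9 * (w 1 x * D (w 1) x) - 6 * (w 3 x * D (w 3) x) - 3 * D (D (w 3)) x)
    (\<lambda>x. - (1/2) * (w 1 x ^ 4 + w 3 x ^ 4) + (3/2) * ((w 1 x)\<^sup>2 * (w 3 x)\<^sup>2)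
      + (5/2) * (D (w 1) x)\<^sup>2 - (1/2) * (D (w 3) x)\<^sup>2
      + (3/2) * (D (w 3) x * (w 1 x)\<^sup>2))"
proof
  show "((\<lambda>x. (9/2) * (w 1 x)\<^sup>2 - 3 * (w 3 x)\<^sup>2 - 3 * D (w 3) x) has_vector_derivative
    9 * (w 1 x * D (w 1) x) - 6 * (w 3 x * D (w 3) x) - 3 * D (D (w 3)) x) (at x)" for x
    \<comment> \<open>Squares become products so that the product rule applies; the derivative it
      yields is then matched with the stated one.\<close>
    unfolding power2_eq_square
    by (rule has_vector_derivative_eq_rhs, (rule has_vector_derivative_diff
        has_vector_derivative_add has_vector_derivative_mult_right has_vector_derivative_mult
        has_der)+) algebra
qed ((assumption | rule quad_decay_rules schwartz_quad_decay schwartz)+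
    | (simp only: ham_density_expand fun_upd_apply index_simps, algebra))+

text \<open>\<open>K\<close> and \<open>L\<close> happen to coincide: \<open>- 3 * v 2\<close>
  multiplies both the square of \<open>u 3\<close> and \<open>v 3\<close>, and so does 3/2 times the
  sum of the squares of \<open>u 1\<close> and \<open>u 2\<close>, up to which of them comes with
  \<open>v 3\<close>.\<close>

lemma quartic_slice_3: "quartic_slice ham_density 3 w
    (\<lambda>x. (3/2) * ((w 1 x)\<^sup>2 + (w 2 x)\<^sup>2) - 3 * D (w 2) x)
    (- (1/2)) (\<lambda>x. (3/2) * ((w 1 x)\<^sup>2 + (w 2 x)\<^sup>2) - 3 * D (w 2) x)
    (\<lambda>x. 3 * (w 1 x * D (w 1) x) + 3 * (w 2 x * D (w 2) x) - 3 * D (D (w 2)) x)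
    (\<lambda>x. - (1/2) * (w 1 x ^ 4 + w 2 x ^ 4) + (3/2) * ((w 1 x)\<^sup>2 * (w 2 x)\<^sup>2)
      + (5/2) * (D (w 1) x)\<^sup>2 - 2 * (D (w 2) x)\<^sup>2
      + (9/2) * (D (w 2) x * (w 1 x)\<^sup>2))"
proof
  show "((\<lambda>x. (3/2) * ((w 1 x)\<^sup>2 + (w 2 x)\<^sup>2) - 3 * D (w 2) x) has_vector_derivative
    3 * (w 1 x * D (w 1) x) + 3 * (w 2 x * D (w 2) x) - 3 * D (D (w 2)) x) (at x)" for x
    unfolding power2_eq_square
    by (rule has_vector_derivative_eq_rhs, (rule has_vector_derivative_diff
        has_vector_derivative_add has_vector_derivative_mult_right has_vector_derivative_mult
        has_der)+) algebra
qed ((assumption | rule quad_decay_rules schwartz_quad_decay schwartz)+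
    | (simp only: ham_density_expand fun_upd_apply index_simps, algebra))+

end

section \<open>Matching the system with its Hamiltonian form\<close>

theorem mainTheorem2:
  fixes \<alpha> :: "'a::{real_normed_field, euclidean_space}"
    and q :: "nat \<Rightarrow> real \<Rightarrow> real \<Rightarrow> 'a"
    and h :: "(nat \<Rightarrow> 'a) \<Rightarrow> (nat \<Rightarrow> 'a) \<Rightarrow> 'a"
  assumes "\<alpha> \<noteq> 0"
    and "\<And>i. i \<in> {1..3} \<Longrightarrow> smooth (q i)"
    and "\<And>i t. i \<in> {1..3} \<Longrightarrow> schwartz (q i t)"
  defines "h \<equiv> \<lambda>u v. (1 / \<alpha>) * ham_density u v"
  shows "(\<forall>t. integrable lborel (\<lambda>x. ham_density (\<lambda>j. q j t x) (\<lambda>j. D (q j t) x)))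
    \<and> (\<forall>t. \<forall>i\<in>{1..3}. has_variational_derivative (hamiltonian \<alpha>) i (\<lambda>j. q j t)
                          (euler_lagrange h i (\<lambda>j. q j t)))
    \<and> (field_equations \<alpha> q \<longleftrightarrow>
         (\<forall>i\<in>{1..3}. \<forall>t x. D (\<lambda>s. q i s x) t = D (euler_lagrange h i (\<lambda>j. q j t)) x))"
proof -
  have sch: "schwartz (q 1 t)" "schwartz (q 2 t)" "schwartz (q 3 t)" for t
    using assms(3) by simp_all
  \<comment> \<open>\<open>X i t\<close> is the flux of the i-th equation, that is, the expression
    under the outer x-derivative; the last branch is the one for i = 3.\<close>
  define X where "X i t y = (if i = (1::nat) then
        - 5 * D (D (q 1 t)) y + 3 * q 1 t y * D (\<lambda>z. 3 * q 2 t z + q 3 t z) y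
              - 2 * q 1 t y ^ 3 + 3 * q 1 t y * ((q 2 t y)\<^sup>2 + (q 3 t y)\<^sup>2)
      else if i = 2 then
        D (D (\<lambda>z. 4 * q 2 t z + 3 * q 3 t z)) y + 3 * q 2 t y * D (q 3 t) y
              - 9 * q 1 t y * D (q 1 t) y + 6 * q 3 t y * D (q 3 t) y
              - 2 * q 2 t y ^ 3 + 3 * q 2 t y * ((q 1 t y)\<^sup>2 + (q 3 t y)\<^sup>2)
      else
        D (D (\<lambda>z. q 3 t z + 3 * q 2 t z)) y - 6 * q 3 t y * D (q 2 t) y
              - 3 * q 1 t y * D (q 1 t) y - 3 * q 2 t y * D (q 2 t) y
              - 2 * q 3 t y ^ 3 + 3 * q 3 t y * ((q 1 t y)\<^sup>2 + (q 2 t y)\<^sup>2))" for i t y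
  have D_lin: "D (\<lambda>z. a * f z + b * g z) = (\<lambda>z. a * D f z + b * D g z)"
    if "\<And>x. f differentiable (at x)" "\<And>x. g differentiable (at x)"
    for a b :: 'a and f g
    by (intro ext D_eq has_vector_derivative_add has_vector_derivative_mult_right
        has_vector_derivative_D that)
  note diff = schwartz_differentiable[OF sch(1)] schwartz_differentiable[OF sch(2)]
    schwartz_differentiable[OF sch(3)]
  have D_sums: "D (\<lambda>z. 3 * q 2 t z + q 3 t z) = (\<lambda>z. 3 * D (q 2 t) z + D (q 3 t) z)"
    "D (D (\<lambda>z. 4 * q 2 t z + 3 * q 3 t z)) = (\<lambda>z. 4 * D (D (q 2 t)) z + 3 * D (D (q 3 t)) z)"
    "D (D (\<lambda>z. q 3 t z + 3 * q 2 t z)) = (\<lambda>z. D (D (q 3 t)) z + 3 * D (D (q 2 t)) z)" for t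
    \<comment> \<open>Second derivatives need linearity twice, for the fields and for their
      derivatives; the coefficient 1 stands for an absent factor.\<close>
    using D_lin[of "q 2 t" "q 3 t" 3 1] D_lin[of "q 2 t" "q 3 t" 4 3]
      D_lin[of "q 3 t" "q 2 t" 1 3] D_lin[of "D (q 2 t)" "D (q 3 t)" 4 3]
      D_lin[of "D (q 3 t)" "D (q 2 t)" 1 3]
    by (simp_all add: diff)
  \<comment> \<open>Where a function is not differentiable, \<open>D\<close> is an unspecified
    value, so this is what allows 1/\<alpha> to be pulled out of \<open>D\<close> below.\<close>
  have X_diff: "X i t differentiable (at x)" for i t x
    unfolding X_def[abs_def] D_sums
    by (cases "i = 1"; cases "i = 2") (auto simp del: One_nat_def intro!: derivative_intros diff)
  note slice1 = quartic_slice_1[of "\<lambda>j. q j t" for t, OF sch]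
    and slice2 = quartic_slice_2[of "\<lambda>j. q j t" for t, OF sch]
    and slice3 = quartic_slice_3[of "\<lambda>j. q j t" for t, OF sch]
  have field_eqs: "field_equations \<alpha> q \<longleftrightarrow>
      (\<forall>t x. \<alpha> * D (\<lambda>s. q 1 s x) t = D (X 1 t) x \<and>
        \<alpha> * D (\<lambda>s. q 2 s x) t = D (X 2 t) x \<and> \<alpha> * D (\<lambda>s. q 3 s x) t = D (X 3 t) x)"
    unfolding field_equations_def X_def[abs_def] by (simp only: index_simps)
  have ham_eq: "hamiltonian \<alpha> =
      (\<lambda>w. (1 / \<alpha>) * (LINT x|lborel. ham_density (\<lambda>j. w j x) (\<lambda>j. D (w j) x)))"
    by (simp add: hamiltonian_def fun_eq_iff)
  \<comment> \<open>Here and in the next two facts the flux is recognised as \<alpha> times the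
    variational derivative, by a ring identity in the fields and their derivatives.\<close>
  have el1: "euler_lagrange h 1 (\<lambda>j. q j t) = (\<lambda>x. (1 / \<alpha>) * X 1 t x)" for t
    unfolding h_def quartic_slice.euler_lagrange_eq[OF slice1]
    by (intro ext arg_cong[where f = "\<lambda>z. (1 / \<alpha>) * z"])
      (simp only: quartic_slice.E_def[OF slice1] X_def D_sums index_simps, algebra)
  have el2: "euler_lagrange h 2 (\<lambda>j. q j t) = (\<lambda>x. (1 / \<alpha>) * X 2 t x)" for t
    unfolding h_def quartic_slice.euler_lagrange_eq[OF slice2]
    by (intro ext arg_cong[where f = "\<lambda>z. (1 / \<alpha>) * z"])
      (simp only: quartic_slice.E_def[OF slice2] X_def D_sums index_simps, algebra)
  have el3: "euler_lagrange h 3 (\<lambda>j. q j t) = (\<lambda>x. (1 / \<alpha>) * X 3 t x)" for t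
    unfolding h_def quartic_slice.euler_lagrange_eq[OF slice3]
    by (intro ext arg_cong[where f = "\<lambda>z. (1 / \<alpha>) * z"])
      (simp only: quartic_slice.E_def[OF slice3] X_def D_sums index_simps, algebra)
  have idx: "(\<forall>i\<in>{1..3}. P i) \<longleftrightarrow> P 1 \<and> P 2 \<and> P 3" for P :: "nat \<Rightarrow> bool"
    unfolding atLeastAtMost_1_3 by simp
  \<comment> \<open>Clearing the factor 1/\<alpha> in both directions uses that \<alpha> is
    nonzero.\<close>
  have DX: "a = D (\<lambda>x. (1 / \<alpha>) * X i t x) x \<longleftrightarrow> \<alpha> * a = D (X i t) x" for a i t x
  proof -
    have "D (\<lambda>x. (1 / \<alpha>) * X i t x) x = (1 / \<alpha>) * D (X i t) x"
      by (intro D_eq has_vector_derivative_mult_right has_vector_derivative_D X_diff)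
    show ?thesis
      unfolding \<open>D _ x = _\<close> using \<open>\<alpha> \<noteq> 0\<close> by (auto simp: field_simps)
  qed
  \<comment> \<open>All three slices describe the same density, so any one of them yields its
    decay.\<close>
  have "integrable lborel (\<lambda>x. ham_density (\<lambda>j. q j t x) (\<lambda>j. D (q j t) x))" for t
    using quad_decay_integrable[OF quartic_slice.density_decay[OF slice1]] .
  moreover have "has_variational_derivative (hamiltonian \<alpha>) i (\<lambda>j. q j t)
      (euler_lagrange h i (\<lambda>j. q j t))" if "i \<in> {1..3}" for i t
  proof -
    have "\<forall>i\<in>{1..3}. has_variational_derivative (hamiltonian \<alpha>) i (\<lambda>j. q j t)
      (euler_lagrange h i (\<lambda>j. q j t))"
      unfolding idx h_def ham_eq quartic_slice.euler_lagrange_eq[OF slice1]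
        quartic_slice.euler_lagrange_eq[OF slice2] quartic_slice.euler_lagrange_eq[OF slice3]
      by (intro conjI quartic_slice.has_variational_derivative[OF slice1]
          quartic_slice.has_variational_derivative[OF slice2]
          quartic_slice.has_variational_derivative[OF slice3])
    with that show ?thesis by blast
  qed
  moreover have "field_equations \<alpha> q \<longleftrightarrow>
      (\<forall>i\<in>{1..3}. \<forall>t x. D (\<lambda>s. q i s x) t = D (euler_lagrange h i (\<lambda>j. q j t)) x)"
    unfolding idx el1 el2 el3 DX field_eqs by blast
  ultimately show ?thesis by blast
qed

end
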